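(* Let $G$ be a finite group and let $S$ be a generating set of $G$ (with $e\notin S$) that contains an element $s$ of order $2$. Then Player 1 has a winning strategy for $\texttt{RAV}(G,S)$.
   Context: Game $\texttt{RAV}(G,S)$: $G$ is a finite group and $S$ a generating set with $e\notin S$. Two players alternate turns, Player 1 first, starting from the empty word $w_0$. On turn $n$ the current player chooses $s_n\in S\cup S^{-1}$, subject to $s_n\neq s_{n-1}^{-1}$ when $n>1$, and forms $w_n=w_{n-1}s_n$. If $w_n$ represents the same element of $G$ as some $w_k$ with $0\le k<n$, the player who formed $w_n$ loses. If a player has no legal move, that player loses. *)

theory Defs
  imports "HOL-Algebra.Generated_Groups" "HOL-Algebra.Multiplicative_Group"
begin

text \<open>
  A position of the game is the word played so far, as the list
  \<open>[s\<^sub>1, \<dots>, s\<^sub>n]\<close> of the chosen letters. Letters are elements of the group, so inverses of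
  letters are taken in the group; in particular an involution is its own inverse letter.
\<close>

definition letters :: "('a, 'b) monoid_scheme \<Rightarrow> 'a set \<Rightarrow> 'a set" where
  "letters G S = S \<union> (\<lambda>x. inv\<^bsub>G\<^esub> x) ` S"

definition word_val :: "('a, 'b) monoid_scheme \<Rightarrow> 'a list \<Rightarrow> 'a" where
  "word_val G w = foldl (\<lambda>g x. g \<otimes>\<^bsub>G\<^esub> x) \<one>\<^bsub>G\<^esub> w"

definition legal_move :: "('a, 'b) monoid_scheme \<Rightarrow> 'a set \<Rightarrow> 'a list \<Rightarrow> 'a \<Rightarrow> bool" where
  "legal_move G S w x \<longleftrightarrow> x \<in> letters G S \<and> (w \<noteq> [] \<longrightarrow> x \<noteq> inv\<^bsub>G\<^esub> (last w))"

definition revisits :: "('a, 'b) monoid_scheme \<Rightarrow> 'a list \<Rightarrow> bool" where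
  "revisits G w \<longleftrightarrow> (\<exists>k<length w. word_val G w = word_val G (take k w))"

definition game_over :: "('a, 'b) monoid_scheme \<Rightarrow> 'a set \<Rightarrow> 'a list \<Rightarrow> bool" where
  "game_over G S w \<longleftrightarrow> revisits G w \<or> (\<forall>x. \<not> legal_move G S w x)"

text \<open>A revisiting move may be made, but it ends the game.\<close>

inductive rav_position :: "('a, 'b) monoid_scheme \<Rightarrow> 'a set \<Rightarrow> 'a list \<Rightarrow> bool"
  for G :: "('a, 'b) monoid_scheme" and S :: "'a set" where
  start: "rav_position G S []"
| move: "rav_position G S w \<Longrightarrow> \<not> game_over G S w \<Longrightarrow> legal_move G S w x
    \<Longrightarrow> rav_position G S (w @ [x])"

datatype player = Player1 | Player2

fun opponent :: "player \<Rightarrow> player" where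
  "opponent Player1 = Player2"
| "opponent Player2 = Player1"

definition to_move :: "'a list \<Rightarrow> player" where
  "to_move w = (if even (length w) then Player1 else Player2)"

text \<open>
  The loser at a position where the game is over: the player who has just moved, if that move
  revisited an element, and otherwise the player who is to move but cannot.
\<close>

definition loser :: "('a, 'b) monoid_scheme \<Rightarrow> 'a list \<Rightarrow> player" where
  "loser G w = (if revisits G w then opponent (to_move w) else to_move w)"

definition strategy ::
    "('a, 'b) monoid_scheme \<Rightarrow> 'a set \<Rightarrow> player \<Rightarrow> ('a list \<Rightarrow> 'a) \<Rightarrow> bool" where
  "strategy G S p \<sigma> \<longleftrightarrow>
    (\<forall>w. rav_position G S w \<and> \<not> game_over G S w \<and> to_move w = p \<longrightarrow> legal_move G S w (\<sigma> w))"

definition follows :: "player \<Rightarrow> ('a list \<Rightarrow> 'a) \<Rightarrow> 'a list \<Rightarrow> bool" where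
  "follows p \<sigma> w \<longleftrightarrow> (\<forall>n<length w. to_move (take n w) = p \<longrightarrow> w ! n = \<sigma> (take n w))"

text \<open>
  The last conjunct rules out that \<open>p\<close> avoids losing merely by playing forever (for a finite group
  no play is infinite).
\<close>

definition winning_strategy ::
    "('a, 'b) monoid_scheme \<Rightarrow> 'a set \<Rightarrow> player \<Rightarrow> ('a list \<Rightarrow> 'a) \<Rightarrow> bool" where
  "winning_strategy G S p \<sigma> \<longleftrightarrow>
    strategy G S p \<sigma> \<and>
    (\<forall>w. rav_position G S w \<and> game_over G S w \<and> follows p \<sigma> w \<longrightarrow> loser G w = opponent p) \<and>
    \<not> (\<exists>f :: nat \<Rightarrow> 'a. \<forall>n. rav_position G S (map f [0..<n]) \<and> follows p \<sigma> (map f [0..<n]))"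

end

theory Submission
  imports Defs
begin

text \<open>
  Player 1 opens with \<open>s\<close> and answers every move of Player 2 by \<open>s\<close>. After each move of Player 1
  the set of visited elements is then a union of left cosets \<open>{g, g s}\<close>. A move of Player 2 that does
  not lose at once enters an unvisited coset, so its second element is free for Player 1; and the
  answer \<open>s\<close> is legal, because Player 2 was not allowed to undo the preceding \<open>s\<close> by playing
  \<open>s\<^sup>-\<^sup>1 = s\<close>.
\<close>

lemma word_val_Nil [simp]: "word_val G [] = \<one>\<^bsub>G\<^esub>"
  by (simp add: word_val_def)

lemma word_val_snoc [simp]: "word_val G (w @ [x]) = word_val G w \<otimes>\<^bsub>G\<^esub> x"
  by (simp add: word_val_def)

lemma word_val_take_Suc:
  "n < length w \<Longrightarrow> word_val G (take (Suc n) w) = word_val G (take n w) \<otimes>\<^bsub>G\<^esub> w ! n"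
  by (simp add: take_Suc_conv_app_nth)

lemma rav_position_nth:
  assumes "rav_position G S w" "n < length w"
  shows "\<not> game_over G S (take n w) \<and> legal_move G S (take n w) (w ! n)"
  using assms
proof (induction rule: rav_position.induct)
  case (move w x)
  then show ?case by (cases "n < length w") (auto simp: nth_append less_Suc_eq)
qed simp

text \<open>A revisit ends the game, so only the full word can repeat an earlier value; hence the
  strict bound on \<open>n\<close>.\<close>

lemma rav_position_word_val_neq:
  assumes "rav_position G S w" "n < length w" "k < n"
  shows "word_val G (take n w) \<noteq> word_val G (take k w)"
  using rav_position_nth[OF assms(1,2)] assms(2,3)
  by (force simp: game_over_def revisits_def)

lemma follows_snoc:
  "follows p \<sigma> (w @ [x]) \<longleftrightarrow> follows p \<sigma> w \<and> (to_move w = p \<longrightarrow> x = \<sigma> w)"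
  by (auto simp: follows_def nth_append less_Suc_eq)

context group
begin

lemma letters_closed: "S \<subseteq> carrier G \<Longrightarrow> letters G S \<subseteq> carrier G"
  by (auto simp: letters_def)

lemma rav_position_word_val_closed:
  assumes "rav_position G S w" "S \<subseteq> carrier G"
  shows "word_val G w \<in> carrier G"
  using assms letters_closed[OF assms(2)]
  by (induction rule: rav_position.induct) (auto simp: legal_move_def)

lemma rav_position_take:
  assumes "rav_position G S w"
  shows "rav_position G S (take n w)"
  using assms
proof (induction arbitrary: n rule: rav_position.induct)
  case (move w x)
  then show ?case
    by (cases "n \<le> length w") (auto intro: rav_position.move)
qed (simp add: rav_position.start)

text \<open>The values of the prefixes would inject the naturals into the finite carrier.\<close>

lemma no_infinite_play:
  assumes "finite (carrier G)" "S \<subseteq> carrier G"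
  shows "\<exists>n. \<not> rav_position G S (map f [0..<n])"
proof (rule ccontr)
  assume "\<not> ?thesis"
  then have pos: "rav_position G S (map f [0..<n])" for n by blast
  define v where "v n = word_val G (map f [0..<n])" for n
  have "v k \<noteq> v n" if "k < n" for k n
    \<comment> \<open>One more letter is needed: being continued is what shows that the first
      \<open>n\<close> letters do not end in a revisit.\<close>
    using rav_position_word_val_neq[OF pos[of "Suc n"], of n k] that
    by (simp add: v_def take_map)
  then have "inj v"
    by (metis injI linorder_neqE_nat)
  moreover have "range v \<subseteq> carrier G"
    using rav_position_word_val_closed[OF pos assms(2)] by (auto simp: v_def)
  ultimately show False
    using assms(1) finite_imageD finite_subset infinite_UNIV_nat by blast
qed

lemma ord_two_involution:
  assumes "s \<in> carrier G" "ord s = 2"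
  shows "s \<otimes> s = \<one>" "inv s = s" "s \<noteq> \<one>"
proof -
  show "s \<otimes> s = \<one>"
    using pow_ord_eq_1[OF assms(1)] assms by (simp add: numeral_2_eq_2)
  then show "inv s = s"
    using assms(1) by (simp add: inv_equality)
  show "s \<noteq> \<one>"
    using assms(2) ord_eq_1[OF assms(1)] by auto
qed

text \<open>Assuming \<open>reply\<close> instead of \<open>follows\<close> lets this lemma serve
  inside the induction which shows that Player 1 indeed always plays \<open>s\<close>.\<close>

lemma involution_legal:
  assumes pos: "rav_position G S w" and ev: "even (length w)"
    and S: "S \<subseteq> carrier G" and s: "s \<in> S" "ord s = 2"
    and reply: "\<And>n. n < length w \<Longrightarrow> even n \<Longrightarrow> w ! n = s"
  shows "legal_move G S w s"
proof (cases w rule: rev_cases)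
  case Nil
  with s show ?thesis by (simp add: legal_move_def letters_def)
next
  case (snoc u x)
  then obtain u' y where u: "u = u' @ [y]"
    using ev by (cases u rule: rev_cases) auto
  have "even (length u')"
    using ev snoc u by simp
  then have y: "y = s"
    using reply[of "length u'"] snoc u by (simp add: nth_append)
  have legal: "legal_move G S u x"
    using rav_position_nth[OF pos, of "length u"] snoc by simp
  have sG: "s \<in> carrier G" using S s by auto
  have xG: "x \<in> carrier G"
    using legal letters_closed[OF S] by (auto simp: legal_move_def)
  have "x \<noteq> s"
    using legal u y ord_two_involution(2)[OF sG s(2)] by (simp add: legal_move_def)
  then have "s \<noteq> inv x"
    using xG ord_two_involution(2)[OF sG s(2)] by auto
  then show ?thesis
    using snoc s by (simp add: legal_move_def letters_def)
qed

text \<open>The prefix values at \<open>n\<close> and \<open>Suc n\<close>, for even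
  \<open>n\<close>, are partners under right multiplication by \<open>s\<close>. If the last value
  equals an earlier one, then their partners agree as well, so a repetition had already occurred
  before the last move.\<close>

lemma involution_not_revisits:
  assumes pos: "rav_position G S w" and odd: "odd (length w)"
    and S: "S \<subseteq> carrier G" and s: "s \<in> S" "ord s = 2"
    and reply: "\<And>n. n < length w \<Longrightarrow> even n \<Longrightarrow> w ! n = s"
  shows "\<not> revisits G w"
proof
  define v where "v n = word_val G (take n w)" for n
  have sG: "s \<in> carrier G" using S s by auto
  note inv_s = ord_two_involution[OF sG s(2)]
  have vG: "v n \<in> carrier G" for n
    using rav_position_word_val_closed[OF rav_position_take[OF pos] S] by (simp add: v_def)
  have step: "v (Suc n) = v n \<otimes> s" if "even n" "n < length w" for n
    using word_val_take_Suc[OF that(2)] reply[OF that(2,1)] by (simp add: v_def)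
  have neq: "v n \<noteq> v k" if "k < n" "n < length w" for k n
    using rav_position_word_val_neq[OF pos that(2,1)] by (simp add: v_def)
  obtain m where m: "length w = Suc m" "even m"
    using odd by (cases "length w") auto
  assume "revisits G w"
  then obtain k where "k < length w" "v (length w) = v k"
    by (auto simp: revisits_def v_def)
  then have k: "k \<le> m" "v m \<otimes> s = v k"
    using step[of m] m by simp_all
  show False
  proof (cases "even k")
    case True
    \<comment> \<open>Multiply by \<open>s\<close> on the right; for even \<open>k\<close> the right
      side is \<open>v (Suc k)\<close>.\<close>
    have eq: "v m = v k \<otimes> s"
      using k(2) vG sG inv_s(1) by (metis m_assoc r_one)
    show False
    proof (cases "k = m")
      case True
      from eq have "v m = v m \<otimes> s"
        unfolding True .
      then show False
        using l_cancel_one'[OF vG sG] inv_s(3) by blast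
    next
      case False
      \<comment> \<open>Parity excludes the case in which \<open>v m = v (Suc k)\<close> would be
        trivial.\<close>
      moreover have "Suc k \<noteq> m"
        using True m(2) by auto
      ultimately have "Suc k < m"
        using k(1) by simp
      then show False
        using neq[of "Suc k" m] step[OF True] eq m(1) by simp
    qed
  next
    case False
    then obtain j where j: "k = Suc j" "even j"
      by (cases k) auto
    \<comment> \<open>Cancelling \<open>s\<close> gives \<open>v m = v j\<close> with
      \<open>j < m\<close>.\<close>
    then have "v m \<otimes> s = v j \<otimes> s"
      using step[of j] k m(1) by simp
    then show False
      using neq[of j m] j k(1) m(1) vG sG by simp
  qed
qed

end

theorem theorem3p9:
  fixes G :: "('a, 'b) monoid_scheme" and S :: "'a set"
  assumes "group G"
    and "finite (carrier G)"
    and "S \<subseteq> carrier G"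
    and "generate G S = carrier G"
    and "\<one>\<^bsub>G\<^esub> \<notin> S"
    and "s \<in> S"
    and "group.ord G s = 2"
  shows "\<exists>\<sigma>. winning_strategy G S Player1 \<sigma>"
proof -
  interpret group G by fact
  \<comment> \<open>A strategy must be legal also at positions that it never reaches, where \<open>s\<close> may be forbidden.\<close>
  define \<sigma> where "\<sigma> w = (if legal_move G S w s then s else SOME x. legal_move G S w x)" for w
  have strat: "strategy G S Player1 \<sigma>"
    unfolding strategy_def game_over_def \<sigma>_def by (auto intro: someI)
  have reply: "\<forall>n<length w. even n \<longrightarrow> w ! n = s"
    if "rav_position G S w" "follows Player1 \<sigma> w" for w
    using that
  proof (induction rule: rav_position.induct)
    case (move w x)
    then have fol: "follows Player1 \<sigma> w" and x: "to_move w = Player1 \<longrightarrow> x = \<sigma> w"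
      by (auto simp: follows_snoc)
    note IH = move.IH[OF fol]
    \<comment> \<open>Since \<open>s\<close> is legal here, \<open>\<sigma>\<close> does not fall
      back on the choice by \<open>SOME\<close>.\<close>
    have "x = s" if "even (length w)"
      using involution_legal[OF move.hyps(1) that assms(3,6,7)] IH x that
      by (simp add: to_move_def \<sigma>_def)
    with IH show ?case
      by (auto simp: nth_append less_Suc_eq)
  qed simp
  have "loser G w = opponent Player1"
    if w: "rav_position G S w" "game_over G S w" "follows Player1 \<sigma> w" for w
  \<comment> \<open>With Player 1 to move, \<open>s\<close> is available, so the game can only have
    ended by a revisit of Player 2. With Player 2 to move there is no revisit, so Player 2 is
    stuck.\<close>
  proof (cases "even (length w)")
    case True
    then have "legal_move G S w s"
      using involution_legal[OF w(1) True assms(3,6,7)] reply[OF w(1,3)] by blast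
    then show ?thesis
      using w(2) True by (auto simp: game_over_def loser_def to_move_def)
  next
    case False
    then have "\<not> revisits G w"
      using involution_not_revisits[OF w(1) False assms(3,6,7)] reply[OF w(1,3)] by blast
    then show ?thesis
      using False by (simp add: loser_def to_move_def)
  qed
  then have "winning_strategy G S Player1 \<sigma>"
    using strat no_infinite_play[OF assms(2,3)] unfolding winning_strategy_def by blast
  then show ?thesis
    by (intro exI)
qed

end
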